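(* Let $\mathcal{H}$ be a complex separable Hilbert space, let $r\ge 2$ be an integer, and let $a_0,\dots,a_{r-1}\in\mathbb{R}$ with $a_{r-1}\ne 0$. Let $\lambda_1,\dots,\lambda_s\in\mathbb{C}$ be the distinct roots of $P(X)=X^r-a_{r-1}X^{r-1}-\cdots-a_0$, with respective multiplicities $m_1,\dots,m_s$. Let $(T_n)_{n\ge 0}$ be a sequence of bounded linear operators on $\mathcal{H}$ satisfying $$T_{n+r}=a_0T_n+a_1T_{n+1}+\cdots+a_{r-1}T_{n+r-1}\qquad\text{for all } n\ge 0.$$ Then there exist unique bounded linear operators $S_{i,j}$ on $\mathcal{H}$, indexed by $1\le i\le s$ and $0\le j\le m_i-1$, such that $$T_n=\sum_{i=1}^s\sum_{j=0}^{m_i-1}S_{i,j}\,n^j\,\lambda_i^n\qquad\text{for all } n\ge 0,$$ where the operators $S_{i,j}$ are uniquely determined by the initial values $T_0,\dots,T_{r-1}$.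
   Context: Convention: $0^0=1$ (so $n^j=1$ when $n=j=0$).
   Formalization: Adds the hypothesis that 0, if it is a root of P, is a simple root; without it the claim fails, e.g. P = X^2(X-1) with T = 0, id, 0, 0, ... has no such form, and for a multiple root 0 uniqueness always fails on a nonzero space. *)

theory Defs
  imports "HOL-Analysis.Analysis" "HOL-Computational_Algebra.Computational_Algebra"
begin

text \<open>
  Complex Hilbert spaces. The class extends the real Banach spaces, so that the topology, the norm
  and \<open>bounded_linear\<close> are those of the library; real scaling is the restriction of complex scaling
  and the norm is the one induced by \<open>cinner\<close>, which is linear in its first argument.
\<close>

class complex_hilbert_space = banach +
  fixes scaleC :: "complex \<Rightarrow> 'a \<Rightarrow> 'a" (infixr \<open>*\<^sub>C\<close> 75)
    and cinner :: "'a \<Rightarrow> 'a \<Rightarrow> complex"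
  assumes scaleC_add_right: "c *\<^sub>C (x + y) = c *\<^sub>C x + c *\<^sub>C y"
    and scaleC_add_left: "(c + d) *\<^sub>C x = c *\<^sub>C x + d *\<^sub>C x"
    and scaleC_scaleC: "c *\<^sub>C (d *\<^sub>C x) = (c * d) *\<^sub>C x"
    and scaleC_one: "1 *\<^sub>C x = x"
    and scaleR_eq_scaleC: "scaleR t x = complex_of_real t *\<^sub>C x"
    and cinner_commute: "cinner x y = cnj (cinner y x)"
    and cinner_add_left: "cinner (x + y) z = cinner x z + cinner y z"
    and cinner_scaleC_left: "cinner (c *\<^sub>C x) y = c * cinner x y"
    and cinner_self: "cinner x x = complex_of_real ((norm x)\<^sup>2)"

instantiation complex :: complex_hilbert_space
begin

definition scaleC_complex :: "complex \<Rightarrow> complex \<Rightarrow> complex" where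
  "scaleC_complex c x = c * x"

definition cinner_complex :: "complex \<Rightarrow> complex \<Rightarrow> complex" where
  "cinner_complex x y = x * cnj y"

instance
  by standard
    (simp_all add: scaleC_complex_def cinner_complex_def algebra_simps scaleR_conv_of_real
      complex_norm_square del: of_real_power)

end

definition bounded_clinear :: "('a::complex_hilbert_space \<Rightarrow> 'a) \<Rightarrow> bool" where
  "bounded_clinear A \<longleftrightarrow> bounded_linear A \<and> (\<forall>c x. A (c *\<^sub>C x) = c *\<^sub>C A x)"

definition char_poly_rec :: "nat \<Rightarrow> (nat \<Rightarrow> real) \<Rightarrow> complex poly" where
  "char_poly_rec r a = monom 1 r - (\<Sum>k<r. monom (complex_of_real (a k)) k)"

text \<open>
  Families of bounded operators indexed by \<open>1 \<le> i \<le> s\<close>, \<open>0 \<le> j \<le> m i - 1\<close>. They are extensional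
  (\<open>undefined\<close> off the index set), so that equality of families is equality at all valid indices.
\<close>

definition operator_families ::
    "nat \<Rightarrow> (nat \<Rightarrow> nat) \<Rightarrow> (nat \<times> nat \<Rightarrow> 'a::complex_hilbert_space \<Rightarrow> 'a) set" where
  "operator_families s m = (SIGMA i:{1..s}. {..<m i}) \<rightarrow>\<^sub>E Collect bounded_clinear"

text \<open>
  Powers follow the convention \<open>0 ^ 0 = 1\<close>, both in \<open>n ^ j\<close> and in \<open>lam i ^ n\<close>. For \<open>lam i = 0\<close> the
  summand with \<open>j = 0\<close> lives at \<open>n = 0\<close> only, and those with \<open>j > 0\<close> vanish for every \<open>n\<close>. Hence a
  multiple root \<open>0\<close> destroys both existence and uniqueness of the coefficients: for
  \<open>P = X ^ 3 - X ^ 2\<close> the solution \<open>0, id, 0, 0, \<dots>\<close> of \<open>T (n + 3) = T (n + 2)\<close> has no such form on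
  a nonzero space. This is why the root \<open>0\<close>, if present, is required to be simple.
\<close>

definition binet_sum ::
    "nat \<Rightarrow> (nat \<Rightarrow> complex) \<Rightarrow> (nat \<Rightarrow> nat) \<Rightarrow>
     (nat \<times> nat \<Rightarrow> 'a::complex_hilbert_space \<Rightarrow> 'a) \<Rightarrow> nat \<Rightarrow> 'a \<Rightarrow> 'a" where
  "binet_sum s lam m S n x =
    (\<Sum>i=1..s. \<Sum>j<m i. (of_nat n ^ j * lam i ^ n) *\<^sub>C S (i, j) x)"

end

theory Submission
  imports Defs "Jordan_Normal_Form.Determinant"
begin

text \<open>
  The \<open>r\<close> scalar sequences \<open>n ^ j * lam i ^ n\<close> (\<open>j < m i\<close>) solve the recurrence, and the proof
  reduces everything to one fact about their values at \<open>n < r\<close>: these form an invertible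
  \<open>r \<times> r\<close> matrix. Inverting it expresses each coefficient \<open>S (i, j)\<close> as a fixed complex
  linear combination of \<open>T 0, \<dots>, T (r - 1)\<close>. This gives uniqueness from the initial values,
  boundedness of the coefficients, and the formula for \<open>n < r\<close>; the formula then propagates to
  all \<open>n\<close> because both of its sides satisfy the same recurrence of order \<open>r\<close>.

  Invertibility and the recurrence come from the same observation. A vector \<open>c\<close> is the
  coefficient vector of a polynomial \<open>Q\<close>, and the sum of the \<open>c n * n ^ j * z ^ n\<close> is the value
  at \<open>z\<close> of \<open>(X d/dX) ^ j Q\<close>. If \<open>(X - z) ^ k\<close> divides \<open>Q\<close>, these values vanish for \<open>j < k\<close>;
  applied to \<open>Q = X ^ n P\<close>, with \<open>P\<close> the characteristic polynomial, this is the recurrence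
  (\<open>poly_euler_op_eq_0_if_power_dvd\<close>). The converse holds for \<open>z \<noteq> 0\<close>, where \<open>X\<close> is a unit modulo
  \<open>X - z\<close> (\<open>power_dvd_if_poly_euler_op_eq_0\<close>), and for \<open>z = 0\<close> it holds trivially when \<open>k = 1\<close>;
  this is where the simplicity of the root \<open>0\<close> enters. So a vector \<open>c\<close> of length \<open>r\<close> orthogonal
  to all the sequences yields a polynomial of degree below \<open>r\<close> that has every root of \<open>P\<close> with at
  least its multiplicity. As the multiplicities add up to \<open>r\<close>, that polynomial is \<open>0\<close>
  (\<open>eq_0_if_all_roots_with_order\<close>), and a square matrix with trivial kernel is invertible
  (\<open>square_system_inverse\<close>).
\<close>

section \<open>The Euler operator and multiple roots\<close>

text \<open>
  The derivation \<open>X d/dX\<close>. It is used in place of the derivative because it acts diagonally on the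
  monomials, multiplying \<open>X ^ n\<close> by \<open>n\<close>, so that its iterates produce the weights \<open>n ^ j\<close>.
\<close>

definition euler_op :: "complex poly \<Rightarrow> complex poly" where
  "euler_op p = pCons 0 (pderiv p)"

lemma coeff_euler_op: "coeff (euler_op p) n = of_nat n * coeff p n"
  by (cases n) (simp_all add: euler_op_def coeff_pderiv)

lemma coeff_euler_op_funpow: "coeff ((euler_op ^^ j) p) n = of_nat n ^ j * coeff p n"
  by (induction j) (simp_all add: coeff_euler_op)

lemma poly_eq_sum_coeff:
  fixes p :: "'a::comm_semiring_1 poly"
  assumes "\<And>n. n \<ge> N \<Longrightarrow> coeff p n = 0"
  shows "poly p x = (\<Sum>n<N. coeff p n * x ^ n)"
proof -
  have "poly p x = (\<Sum>n\<le>degree p. coeff p n * x ^ n)"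
    by (rule poly_altdef)
  also have "\<dots> = (\<Sum>n\<le>degree p + N. coeff p n * x ^ n)"
    by (rule sum.mono_neutral_left) (auto simp: coeff_eq_0)
  also have "\<dots> = (\<Sum>n<N. coeff p n * x ^ n)"
    by (rule sum.mono_neutral_right) (auto simp: assms)
  finally show ?thesis .
qed

text \<open>
  The bridge between polynomials and sequences: pairing the coefficients of \<open>p\<close> with the sequence
  \<open>n ^ j * z ^ n\<close> is an evaluation at \<open>z\<close>. It respects \<open>0 ^ 0 = 1\<close>, for \<open>z = 0\<close> as well.
\<close>

lemma poly_euler_op_funpow:
  assumes "\<And>n. n \<ge> N \<Longrightarrow> coeff p n = 0"
  shows "poly ((euler_op ^^ j) p) z = (\<Sum>n<N. coeff p n * (of_nat n ^ j * z ^ n))"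
  by (subst poly_eq_sum_coeff[where N = N])
    (simp_all add: assms coeff_euler_op_funpow mult_ac)

lemma euler_op_eq_mult: "euler_op p = [:0, 1:] * pderiv p"
  by (simp add: euler_op_def)

text \<open>
  Differentiation lowers the order of a root by exactly one, and multiplication by \<open>X\<close> cannot lower
  it further.
\<close>

lemma power_dvd_euler_op:
  assumes "[:-z, 1:] ^ Suc k dvd p"
  shows "[:-z, 1:] ^ k dvd euler_op p"
proof (cases "p = 0 \<or> pderiv p = 0")
  case True
  then show ?thesis by (auto simp: euler_op_def)
next
  case False
  then have "Suc k \<le> order z p" using iffD1[OF order_divides assms] by blast
  moreover from this False have "order z p = Suc (order z (pderiv p))"
    by (intro order_pderiv) (auto simp: order_root)
  ultimately have "[:-z, 1:] ^ k dvd pderiv p" by (simp add: order_divides)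
  then show ?thesis unfolding euler_op_eq_mult by (rule dvd_mult)
qed

lemma poly_euler_op_eq_0_if_power_dvd:
  assumes "[:-z, 1:] ^ k dvd p" "j < k"
  shows "poly ((euler_op ^^ j) p) z = 0"
  using assms
proof (induction j arbitrary: k p)
  case 0
  then have "[:-z, 1:] dvd p" by (metis dvd_power dvd_trans)
  then show ?case by (simp add: poly_eq_0_iff_dvd)
next
  case (Suc j)
  then obtain k' where k: "k = Suc k'" by (cases k) auto
  have "[:-z, 1:] ^ k' dvd euler_op p"
    using Suc.prems(1) unfolding k by (rule power_dvd_euler_op)
  moreover have "j < k'" using Suc.prems(2) k by simp
  ultimately have "poly ((euler_op ^^ j) (euler_op p)) z = 0" by (rule Suc.IH)
  then show ?case by (simp only: funpow_Suc_right o_apply)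
qed

text \<open>
  Conversely, a value \<open>0\<close> at \<open>z\<close> adds one to the order that is known for \<open>X d/dX p\<close>, since the factor
  \<open>X\<close> has no root at \<open>z\<close>. This fails at \<open>z = 0\<close>: there all the values with \<open>j > 0\<close> vanish for every
  \<open>p\<close>.
\<close>

lemma power_dvd_if_poly_euler_op_eq_0:
  assumes "z \<noteq> 0" and "\<And>j. j < k \<Longrightarrow> poly ((euler_op ^^ j) p) z = 0"
  shows "[:-z, 1:] ^ k dvd p"
  using assms(2)
proof (induction k arbitrary: p)
  case (Suc k)
  show ?case
  proof (cases "p = 0")
    case False
    have root: "poly p z = 0" using Suc.prems[OF zero_less_Suc] by simp
    have "poly ((euler_op ^^ j) (euler_op p)) z = 0" if "j < k" for j
      using Suc.prems[of "Suc j"] that unfolding funpow_Suc_right o_apply by blast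
    then have "[:-z, 1:] ^ k dvd euler_op p" by (rule Suc.IH)
    moreover have "pderiv p \<noteq> 0"
    proof
      assume "pderiv p = 0"
      then have "degree p = 0" by (simp add: pderiv_eq_0_iff)
      then obtain c where "p = [:c:]" by (rule degree_eq_zeroE)
      with root False show False by simp
    qed
    moreover from this have "order z (euler_op p) = order z (pderiv p)"
      using \<open>z \<noteq> 0\<close> unfolding euler_op_eq_mult
      by (subst order_mult) (auto simp: order_0I simp del: mult_pCons_left)
    ultimately have "k \<le> order z (pderiv p)" by (simp add: order_divides euler_op_def)
    then show ?thesis
      using order_pderiv[OF False root] by (subst order_divides) simp
  qed simp
qed simp

section \<open>The roots of the characteristic polynomial\<close>

lemma coeff_char_poly_rec:
  "coeff (char_poly_rec r a) n =
    (if n = r then 1 else if n < r then - complex_of_real (a n) else 0)"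
  by (simp add: char_poly_rec_def coeff_sum)

lemma degree_char_poly_rec: "degree (char_poly_rec r a) = r"
  by (rule antisym) (auto intro!: degree_le le_degree simp: coeff_char_poly_rec)

lemma char_poly_rec_nonzero: "char_poly_rec r a \<noteq> 0"
  using coeff_char_poly_rec[of r a r] by auto

lemma sum_order_eq_degree:
  fixes p :: "complex poly"
  assumes "p \<noteq> 0"
  shows "(\<Sum>z | poly p z = 0. order z p) = degree p"
proof -
  have "degree p = degree (Polynomial.smult (lead_coeff p) (\<Prod>z|poly p z = 0. [:-z, 1:] ^ order z p))"
    by (simp only: complex_poly_decompose)
  also have "\<dots> = (\<Sum>z | poly p z = 0. order z p)"
    using assms by (simp add: degree_prod_sum_eq degree_power_eq)
  finally show ?thesis by simp
qed

text \<open>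
  Over the complex numbers the orders of the roots of \<open>p\<close> sum to its degree, which leaves no room
  for them among the roots of a nonzero polynomial of smaller degree.
\<close>

lemma eq_0_if_all_roots_with_order:
  fixes p q :: "complex poly"
  assumes "p \<noteq> 0" "degree q < degree p"
    and dvd: "\<And>z. poly p z = 0 \<Longrightarrow> [:-z, 1:] ^ order z p dvd q"
  shows "q = 0"
proof (rule ccontr)
  assume "q \<noteq> 0"
  have le: "order z p \<le> order z q" if "poly p z = 0" for z
    using dvd[OF that] \<open>q \<noteq> 0\<close> by (simp add: order_divides)
  have sub: "{z. poly p z = 0} \<subseteq> {z. poly q z = 0}"
    using le \<open>p \<noteq> 0\<close> by (fastforce simp: order_root)
  have "degree p = (\<Sum>z | poly p z = 0. order z p)"
    using sum_order_eq_degree[OF \<open>p \<noteq> 0\<close>] by simp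
  also have "\<dots> \<le> (\<Sum>z | poly p z = 0. order z q)"
    by (intro sum_mono le) simp
  also have "\<dots> \<le> (\<Sum>z | poly q z = 0. order z q)"
    by (intro sum_mono2 sub poly_roots_finite \<open>q \<noteq> 0\<close>) simp
  also have "\<dots> \<le> degree q" by (rule sum_order_le_degree[OF \<open>q \<noteq> 0\<close>])
  finally show False using assms(2) by simp
qed

section \<open>Square linear systems\<close>

text \<open>
  Injectivity is assumed on one side, for combinations over \<open>n\<close>, while both composites with the
  inverse are obtained: the first identity recovers coefficients from values (uniqueness), the second
  recovers values from coefficients (existence). The unknowns keep their index set \<open>J\<close>, so that the
  enumeration needed to form a matrix stays inside the proof.
\<close>

lemma square_system_inverse:
  fixes u :: "'i \<Rightarrow> nat \<Rightarrow> 'f::field"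
  assumes "finite J" "card J = r"
    and inj: "\<And>c. (\<And>p. p \<in> J \<Longrightarrow> (\<Sum>n<r. c n * u p n) = 0) \<Longrightarrow> \<forall>n<r. c n = 0"
  obtains d where
    "\<And>p q. p \<in> J \<Longrightarrow> q \<in> J \<Longrightarrow> (\<Sum>n<r. d p n * u q n) = of_bool (p = q)"
    "\<And>n k. n < r \<Longrightarrow> k < r \<Longrightarrow> (\<Sum>p\<in>J. u p n * d p k) = of_bool (n = k)"
proof -
  obtain e where e: "bij_betw e {..<r} J"
    using ex_bij_betw_nat_finite[OF \<open>finite J\<close>] \<open>card J = r\<close> by (auto simp: atLeast0LessThan)
  define A where "A = mat r r (\<lambda>(i, n). u (e i) n)"
  have A: "A \<in> carrier_mat r r" by (simp add: A_def)
  have "det A \<noteq> 0"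
  proof
    assume "det A = 0"
    then obtain v where v: "v \<in> carrier_vec r" "v \<noteq> 0\<^sub>v r" "A *\<^sub>v v = 0\<^sub>v r"
      using det_0_iff_vec_prod_zero_field[OF A] by blast
    have "\<forall>n<r. vec_index v n = 0"
    proof (rule inj)
      fix p assume "p \<in> J"
      then obtain i where i: "i < r" "p = e i"
        using bij_betw_imp_surj_on[OF e] by auto
      have "vec_index (A *\<^sub>v v) i = 0" using v(3) i by simp
      then show "(\<Sum>n<r. vec_index v n * u p n) = 0"
        using i v(1) by (simp add: A_def scalar_prod_def atLeast0LessThan mult.commute)
    qed
    then have "v = 0\<^sub>v r" using v(1) by (intro eq_vecI) auto
    with v(2) show False ..
  qed
  from det_non_zero_imp_unit[OF A this, of undefined]
  obtain B where B: "B \<in> carrier_mat r r" "A * B = 1\<^sub>m r" "B * A = 1\<^sub>m r"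
    by (auto simp: Units_def ring_mat_def)
  define d where "d p n = index_mat B (n, the_inv_into {..<r} e p)" for p n
  have d: "d (e i) n = index_mat B (n, i)" if "i < r" for i n
    using that e by (simp add: d_def the_inv_into_f_f bij_betw_def)
  show thesis
  proof
    fix p q assume "p \<in> J" "q \<in> J"
    then obtain i k where ik: "i < r" "p = e i" "k < r" "q = e k"
      using bij_betw_imp_surj_on[OF e] by auto
    have "(\<Sum>n<r. d p n * u q n) = index_mat (A * B) (k, i)"
      using ik A B(1) by (simp add: d A_def scalar_prod_def atLeast0LessThan mult.commute)
    also have "\<dots> = of_bool (p = q)"
      using ik e unfolding B(2) by (auto simp: bij_betw_def inj_on_def)
    finally show "(\<Sum>n<r. d p n * u q n) = of_bool (p = q)" .
  next
    fix n k assume nk: "n < r" "k < r"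
    have "(\<Sum>p\<in>J. u p n * d p k) = (\<Sum>i<r. u (e i) n * d (e i) k)"
      by (rule sum.reindex_bij_betw[OF e, symmetric])
    also have "\<dots> = index_mat (B * A) (k, n)"
      using nk A B(1) by (simp add: d A_def scalar_prod_def atLeast0LessThan mult.commute)
    also have "\<dots> = of_bool (n = k)" using nk unfolding B(3) by auto
    finally show "(\<Sum>p\<in>J. u p n * d p k) = of_bool (n = k)" .
  qed
qed

section \<open>Complex scaling of bounded operators\<close>

interpretation scaleC: vector_space "scaleC :: complex \<Rightarrow> 'h::complex_hilbert_space \<Rightarrow> 'h"
  by standard (simp_all add: scaleC_add_right scaleC_add_left scaleC_scaleC scaleC_one)

lemma norm_scaleC: "norm (c *\<^sub>C x) = cmod c * norm (x :: 'h::complex_hilbert_space)"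
proof -
  have "cinner (c *\<^sub>C x) (c *\<^sub>C x) = c * cnj c * cinner x x"
    by (metis cinner_commute cinner_scaleC_left complex_cnj_mult mult.assoc)
  then have "complex_of_real ((norm (c *\<^sub>C x))\<^sup>2) = complex_of_real ((cmod c * norm x)\<^sup>2)"
    by (simp only: cinner_self complex_norm_square[symmetric] power_mult_distrib of_real_mult)
  then have "(norm (c *\<^sub>C x))\<^sup>2 = (cmod c * norm x)\<^sup>2"
    by (simp only: of_real_eq_iff)
  then show ?thesis by (simp add: power2_eq_iff_nonneg)
qed

lemma bounded_clinear_scaleC:
  assumes "bounded_clinear A"
  shows "bounded_clinear (\<lambda>x. c *\<^sub>C A x)"
proof -
  have A: "bounded_linear A" and hom: "\<And>b x. A (b *\<^sub>C x) = b *\<^sub>C A x"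
    using assms by (auto simp: bounded_clinear_def)
  have "bounded_linear (\<lambda>x :: 'a. c *\<^sub>C x)"
    by (rule bounded_linear_intro[where K = "cmod c"])
      (simp_all add: scaleC_add_right scaleR_eq_scaleC scaleC_scaleC norm_scaleC mult.commute)
  from bounded_linear_compose[OF this A] show ?thesis
    by (simp add: bounded_clinear_def hom scaleC_scaleC mult.commute)
qed

lemma bounded_clinear_sum:
  assumes "\<And>n. n \<in> N \<Longrightarrow> bounded_clinear (A n)"
  shows "bounded_clinear (\<lambda>x. \<Sum>n\<in>N. A n x)"
  using assms by (auto simp: bounded_clinear_def scaleC.scale_sum_right intro!: bounded_linear_sum)

section \<open>The Binet formula\<close>

theorem theorem4p2:
  fixes T :: "nat \<Rightarrow> 'h::complex_hilbert_space \<Rightarrow> 'h"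
    and a :: "nat \<Rightarrow> real"
    and r s :: nat
    and lam :: "nat \<Rightarrow> complex"
    and m :: "nat \<Rightarrow> nat"
  assumes separable: "separable_space (euclidean :: 'h topology)"
    and r: "r \<ge> 2"
    and a_last: "a (r - 1) \<noteq> 0"
    and roots_distinct: "inj_on lam {1..s}"
    and roots: "lam ` {1..s} = {z. poly (char_poly_rec r a) z = 0}"
    and mult: "\<And>i. i \<in> {1..s} \<Longrightarrow> m i = order (lam i) (char_poly_rec r a)"
    and zero_root_simple: "\<And>i. i \<in> {1..s} \<Longrightarrow> lam i = 0 \<Longrightarrow> m i = 1"
    and T_bounded: "\<And>n. bounded_clinear (T n)"
    and T_rec: "\<And>n x. T (n + r) x = (\<Sum>k<r. complex_of_real (a k) *\<^sub>C T (n + k) x)"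
  shows "(\<exists>!S. S \<in> operator_families s m \<and> (\<forall>n. T n = binet_sum s lam m S n)) \<and>
         (\<exists>!S. S \<in> operator_families s m \<and> (\<forall>n<r. T n = binet_sum s lam m S n))"
proof -
  let ?P = "char_poly_rec r a"
  define J where "J = (SIGMA i:{1..s}. {..<m i})"
  define u :: "nat \<times> nat \<Rightarrow> nat \<Rightarrow> complex"
    where "u p n = of_nat n ^ snd p * lam (fst p) ^ n" for p n
  have "finite J" by (simp add: J_def)
  have "card J = (\<Sum>i\<in>{1..s}. order (lam i) ?P)"
    by (simp add: J_def mult)
  also have "\<dots> = (\<Sum>z\<in>lam ` {1..s}. order z ?P)"
    using roots_distinct by (simp add: sum.reindex)
  finally have "card J = r"
    unfolding roots by (simp add: sum_order_eq_degree char_poly_rec_nonzero degree_char_poly_rec)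

  have binet: "binet_sum s lam m S n x = (\<Sum>p\<in>J. u p n *\<^sub>C S p x)"
    for S :: "nat \<times> nat \<Rightarrow> 'h \<Rightarrow> 'h" and n x
    by (simp add: binet_sum_def J_def u_def sum.Sigma case_prod_unfold)

  have u_rec: "u p (n + r) = (\<Sum>k<r. complex_of_real (a k) * u p (n + k))"
    if pJ: "p \<in> J" for p n
  proof -
    obtain i j where p: "p = (i, j)" "i \<in> {1..s}" "j < m i"
      using pJ by (auto simp: J_def)
    \<comment> \<open>The recurrence at \<open>n\<close> says that \<open>u p\<close> pairs to \<open>0\<close> with the coefficients of \<open>X ^ n P\<close>.\<close>
    let ?Q = "monom 1 n * ?P"
    have coeff_Q: "coeff ?Q k = (if k < n then 0 else coeff ?P (k - n))" for k
      by (simp add: coeff_monom_mult)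
    have "[:- lam i, 1:] ^ m i dvd ?P"
      by (simp add: mult[OF p(2)] order_1)
    then have "poly ((euler_op ^^ j) ?Q) (lam i) = 0"
      by (intro poly_euler_op_eq_0_if_power_dvd[OF _ p(3)] dvd_mult)
    then have "0 = (\<Sum>k<n + Suc r. coeff ?Q k * u p k)"
      unfolding u_def p fst_conv snd_conv
      by (subst (asm) poly_euler_op_funpow[where N = "n + Suc r"])
        (auto simp: coeff_Q coeff_char_poly_rec)
    also have "\<dots> = (\<Sum>k<Suc r. coeff ?P k * u p (n + k))"
    proof -
      have "(\<Sum>k<n + Suc r. coeff ?Q k * u p k) = (\<Sum>k\<in>{n..<n + Suc r}. coeff ?Q k * u p k)"
        by (rule sum.mono_neutral_right) (auto simp: coeff_Q)
      also have "\<dots> = (\<Sum>k<Suc r. coeff ?P k * u p (n + k))"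
        by (rule sum.reindex_bij_witness[of _ "\<lambda>k. n + k" "\<lambda>k. k - n"]) (auto simp: coeff_Q)
      finally show ?thesis .
    qed
    also have "\<dots> = u p (n + r) - (\<Sum>k<r. complex_of_real (a k) * u p (n + k))"
      by (simp add: coeff_char_poly_rec sum_negf)
    finally show ?thesis by simp
  qed

  have inj: "\<forall>n<r. c n = 0" if c: "\<And>p. p \<in> J \<Longrightarrow> (\<Sum>n<r. c n * u p n) = 0" for c
  proof -
    define Q where "Q = (\<Sum>n<r. monom (c n) n)"
    have coeff_Q: "coeff Q n = (if n < r then c n else 0)" for n
      by (simp add: Q_def coeff_sum)
    have vanish: "poly ((euler_op ^^ j) Q) (lam i) = 0" if "i \<in> {1..s}" "j < m i" for i j
      using c[of "(i, j)"] that
      by (subst poly_euler_op_funpow[where N = r]) (auto simp: coeff_Q u_def J_def)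
    have "Q = 0"
    proof (rule eq_0_if_all_roots_with_order[OF char_poly_rec_nonzero])
      show "degree Q < degree ?P"
        using r by (auto simp: degree_char_poly_rec coeff_Q intro!: degree_lessI)
    next
      fix z assume "poly ?P z = 0"
      then obtain i where i: "i \<in> {1..s}" "z = lam i" using roots by blast
      show "[:-z, 1:] ^ order z ?P dvd Q"
      proof (cases "z = 0")
        case True
        then show ?thesis
          using i vanish[of i 0] zero_root_simple[of i] mult[of i]
          by (simp add: poly_eq_0_iff_dvd)
      next
        case False
        then show ?thesis
          using i vanish[of i] mult[of i] by (intro power_dvd_if_poly_euler_op_eq_0) auto
      qed
    qed
    then show ?thesis using coeff_Q by (metis coeff_0)
  qed

  obtain d where
    dual: "\<And>p q. p \<in> J \<Longrightarrow> q \<in> J \<Longrightarrow> (\<Sum>n<r. d p n * u q n) = of_bool (p = q)" and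
    interp: "\<And>n k. n < r \<Longrightarrow> k < r \<Longrightarrow> (\<Sum>p\<in>J. u p n * d p k) = of_bool (n = k)"
    using square_system_inverse[OF \<open>finite J\<close> \<open>card J = r\<close> inj] by blast
  define S0 where "S0 = (\<lambda>p\<in>J. \<lambda>x. \<Sum>n<r. d p n *\<^sub>C T n x)"
  have S0: "S0 p x = (\<Sum>n<r. d p n *\<^sub>C T n x)" if "p \<in> J" for p x
    using that by (simp add: S0_def)

  have S0_fam: "S0 \<in> operator_families s m"
    unfolding operator_families_def J_def[symmetric] S0_def
    by (auto intro!: bounded_clinear_sum bounded_clinear_scaleC T_bounded)

  have S0_init: "T n x = (\<Sum>p\<in>J. u p n *\<^sub>C S0 p x)" if "n < r" for n x
  proof -
    have "(\<Sum>p\<in>J. u p n *\<^sub>C S0 p x) = (\<Sum>p\<in>J. \<Sum>k<r. (u p n * d p k) *\<^sub>C T k x)"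
      by (simp add: S0 scaleC.scale_sum_right scaleC_scaleC)
    also have "\<dots> = (\<Sum>k<r. (\<Sum>p\<in>J. u p n * d p k) *\<^sub>C T k x)"
      by (subst sum.swap) (simp add: scaleC.scale_sum_left)
    also have "\<dots> = (\<Sum>k<r. if k = n then T k x else 0)"
      by (rule sum.cong) (auto simp: interp that)
    also have "\<dots> = T n x" using that by simp
    finally show ?thesis by simp
  qed

  have S0_all: "T n x = (\<Sum>p\<in>J. u p n *\<^sub>C S0 p x)" for n x
  proof (induction n rule: less_induct)
    case (less n)
    show ?case
    proof (cases "n < r")
      case False
      then obtain l where n: "n = l + r" by (metis add.commute le_Suc_ex not_less)
      have "T n x = (\<Sum>k<r. complex_of_real (a k) *\<^sub>C (\<Sum>p\<in>J. u p (l + k) *\<^sub>C S0 p x))"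
        unfolding n T_rec by (intro sum.cong refl) (simp add: less n)
      also have "\<dots> = (\<Sum>p\<in>J. \<Sum>k<r. (complex_of_real (a k) * u p (l + k)) *\<^sub>C S0 p x)"
        by (subst sum.swap) (simp add: scaleC.scale_sum_right scaleC_scaleC)
      also have "\<dots> = (\<Sum>p\<in>J. u p n *\<^sub>C S0 p x)"
        by (simp add: n u_rec scaleC.scale_sum_left)
      finally show ?thesis .
    qed (rule S0_init)
  qed

  have unique: "S = S0"
    if fam: "S \<in> operator_families s m" and eq: "\<forall>n<r. T n = binet_sum s lam m S n" for S
  proof (rule PiE_ext)
    show "S \<in> J \<rightarrow>\<^sub>E Collect bounded_clinear" "S0 \<in> J \<rightarrow>\<^sub>E Collect bounded_clinear"
      using fam S0_fam by (simp_all add: operator_families_def J_def)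
    fix p assume p: "p \<in> J"
    show "S p = S0 p"
    proof
      fix x
      have "S0 p x = (\<Sum>n<r. \<Sum>q\<in>J. (d p n * u q n) *\<^sub>C S q x)"
        using eq by (simp add: S0 p binet scaleC.scale_sum_right scaleC_scaleC)
      also have "\<dots> = (\<Sum>q\<in>J. (\<Sum>n<r. d p n * u q n) *\<^sub>C S q x)"
        by (subst sum.swap) (simp add: scaleC.scale_sum_left)
      also have "\<dots> = (\<Sum>q\<in>J. if q = p then S q x else 0)"
        by (rule sum.cong) (auto simp: dual p)
      also have "\<dots> = S p x" using p \<open>finite J\<close> by simp
      finally show "S p x = S0 p x" by simp
    qed
  qed
  have "T n = binet_sum s lam m S0 n" for n
    by (rule ext) (simp add: binet S0_all[of n])
  with S0_fam unique show ?thesis by metis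
qed

end
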